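(* Let $H\in\mathbb{R}^{k\times d}$, let $\Gamma\in\mathbb{R}^{k\times k}$ be symmetric positive definite, and let $\hat\pi\in\mathcal{P}_2(\mathbb{R}^d)$ with $\mathrm{Cov}(\hat\pi)\succ 0$. For each realization of the observation $y^\dagger\in\mathbb{R}^k$ and of the observational noise $\eta\sim N(0,\Gamma)$ (i.e. for each fixed pair of vectors $y^\dagger,\eta\in\mathbb{R}^k$), the variational problem $$\operatorname*{argmin}_{\mu\in\mathcal{P}_2(\mathbb{R}^d)}\ \frac12 W_2^2(\mu,\hat\pi;\mathrm{Cov}(\hat\pi))+\frac12\int_{\mathbb{R}^d}|Hx+\eta-y^\dagger|_\Gamma^2\,d\mu(x)$$ has a unique solution $\pi_\eta\in\mathcal{P}_2(\mathbb{R}^d)$. Moreover, the $\mathrm{Cov}(\hat\pi)$-weighted optimal transport map $T_{\hat\pi}^{\pi_\eta}$ from $\hat\pi$ to $\pi_\eta$ is given by $$T_{\hat\pi}^{\pi_\eta}(\hat x)=\hat x-\mathrm{Cov}(\hat\pi)H^T\left(H\,\mathrm{Cov}(\hat\pi)H^T+\Gamma\right)^{-1}(H\hat x+\eta-y^\dagger),$$ which is precisely the update rule for the analysis step of the mean-field ensemble Kalman filter.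
   Context: $\mathcal{P}_2(\mathbb{R}^d)$ is the set of Borel probability measures on $\mathbb{R}^d$ with finite second moments; $\mathrm{Cov}(\mu)$ is the covariance matrix of $\mu$. For a symmetric positive definite matrix $M\in\mathbb{R}^{q\times q}$, $|v|_M^2:=v^TM^{-1}v$ for $v\in\mathbb{R}^q$. For symmetric positive definite $M\in\mathbb{R}^{d\times d}$ and $\mu,\nu\in\mathcal{P}_2(\mathbb{R}^d)$, the $M$-weighted 2-Wasserstein distance is $$W_2(\mu,\nu;M):=\inf_{\gamma\in\Pi(\mu,\nu)}\left(\iint |x-y|_M^2\,d\gamma(x,y)\right)^{1/2},$$ where $\Pi(\mu,\nu)$ is the set of couplings of $\mu$ and $\nu$ (probability measures on $\mathbb{R}^d\times\mathbb{R}^d$ with first marginal $\mu$ and second marginal $\nu$). A map $T:\mathbb{R}^d\to\mathbb{R}^d$ is an $M$-weighted optimal transport map from $\mu$ to $\nu$ if $(\mathrm{id}\times T)_\#\mu$ is a coupling of $\mu,\nu$ attaining this infimum. The analysis step of the mean-field ensemble Kalman filter maps a random vector $\hat X\sim\hat\pi$, given an observation $y^\dagger$ and noise $\eta\sim N(0,\Gamma)$, to $X=\hat X-\mathrm{Cov}(\hat\pi)H^T(H\mathrm{Cov}(\hat\pi)H^T+\Gamma)^{-1}(H\hat X+\eta-y^\dagger)$. *)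

theory Defs
  imports "HOL-Probability.Probability"
begin

definition P2 :: "('a::euclidean_space) measure set" where
  "P2 = {\<mu>. prob_space \<mu> \<and> sets \<mu> = sets borel \<and> integrable \<mu> (\<lambda>x. (norm x)\<^sup>2)}"

definition mean :: "(real ^ 'd) measure \<Rightarrow> real ^ 'd" where
  "mean \<mu> = (LINT x|\<mu>. x)"

definition Cov :: "(real ^ 'd) measure \<Rightarrow> real ^ 'd ^ 'd" where
  "Cov \<mu> = (\<chi> i j. LINT x|\<mu>. (x $ i - mean \<mu> $ i) * (x $ j - mean \<mu> $ j))"

definition sym_pos_def :: "real ^ 'q ^ 'q \<Rightarrow> bool" where
  "sym_pos_def M \<longleftrightarrow> transpose M = M \<and> (\<forall>v. v \<noteq> 0 \<longrightarrow> v \<bullet> (M *v v) > 0)"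

definition wnorm :: "real ^ 'q ^ 'q \<Rightarrow> real ^ 'q \<Rightarrow> real" where
  "wnorm M v = sqrt (v \<bullet> (matrix_inv M *v v))"

definition couplings ::
  "(real ^ 'd) measure \<Rightarrow> (real ^ 'd) measure \<Rightarrow> ((real ^ 'd) \<times> (real ^ 'd)) measure set" where
  "couplings \<mu> \<nu> = {\<gamma>. prob_space \<gamma> \<and> sets \<gamma> = sets borel
     \<and> distr \<gamma> borel fst = \<mu> \<and> distr \<gamma> borel snd = \<nu>}"

(* For \<mu>, \<nu> in P2 and M symmetric positive definite, the cost is integrable against
   every coupling, so the Bochner integral below is the usual (finite) transport cost;
   the set of couplings is nonempty because it contains the product measure. *)
definition transport_cost ::
  "real ^ 'd ^ 'd \<Rightarrow> ((real ^ 'd) \<times> (real ^ 'd)) measure \<Rightarrow> real" where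
  "transport_cost M \<gamma> = sqrt (LINT (x, y)|\<gamma>. (wnorm M (x - y))\<^sup>2)"

definition W2 :: "(real ^ 'd) measure \<Rightarrow> (real ^ 'd) measure \<Rightarrow> real ^ 'd ^ 'd \<Rightarrow> real" where
  "W2 \<mu> \<nu> M = (INF \<gamma>\<in>couplings \<mu> \<nu>. transport_cost M \<gamma>)"

definition optimal_transport_map ::
  "real ^ 'd ^ 'd \<Rightarrow> (real ^ 'd) measure \<Rightarrow> (real ^ 'd) measure
    \<Rightarrow> (real ^ 'd \<Rightarrow> real ^ 'd) \<Rightarrow> bool" where
  "optimal_transport_map M \<mu> \<nu> T \<longleftrightarrow>
     T \<in> borel_measurable borel
     \<and> distr \<mu> borel (\<lambda>x. (x, T x)) \<in> couplings \<mu> \<nu>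
     \<and> transport_cost M (distr \<mu> borel (\<lambda>x. (x, T x))) = W2 \<mu> \<nu> M"

definition analysis_objective ::
  "real ^ 'd ^ 'k \<Rightarrow> real ^ 'k ^ 'k \<Rightarrow> (real ^ 'd) measure \<Rightarrow> real ^ 'k \<Rightarrow> real ^ 'k
    \<Rightarrow> (real ^ 'd) measure \<Rightarrow> real" where
  "analysis_objective H \<Gamma> \<pi>h y \<eta> \<mu> =
     1/2 * (W2 \<mu> \<pi>h (Cov \<pi>h))\<^sup>2
     + 1/2 * (LINT x|\<mu>. (wnorm \<Gamma> (H *v x + \<eta> - y))\<^sup>2)"

text \<open>Analysis step of the mean-field ensemble Kalman filter, pointwise in the realizations
  of the forecast state \<open>xh\<close> (with law \<open>\<pi>h\<close>) and of the noise \<open>\<eta>\<close>.\<close>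

definition enkf_analysis ::
  "real ^ 'd ^ 'k \<Rightarrow> real ^ 'k ^ 'k \<Rightarrow> (real ^ 'd) measure \<Rightarrow> real ^ 'k \<Rightarrow> real ^ 'k
    \<Rightarrow> real ^ 'd \<Rightarrow> real ^ 'd" where
  "enkf_analysis H \<Gamma> \<pi>h y \<eta> xh =
     xh - (Cov \<pi>h ** transpose H ** matrix_inv (H ** Cov \<pi>h ** transpose H + \<Gamma>))
            *v (H *v xh + \<eta> - y)"

end

theory Submission
  imports Defs
begin

text \<open>
  Write \<open>C\<close> for the forecast covariance and \<open>T\<close> for the Kalman update. For a coupling \<open>\<gamma>\<close> of a
  candidate \<open>\<mu>\<close> with the forecast \<open>\<pi>h\<close>, the objective with \<open>W2\<close> replaced by the cost of \<open>\<gamma>\<close> is an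
  integral over \<open>\<gamma>\<close> of a quadratic function of \<open>x\<close> and \<open>xh\<close>, which for fixed \<open>xh\<close> is minimized at
  \<open>x = T xh\<close>. Completing the square splits it into a term depending on \<open>xh\<close> only, whose integral
  \<open>min_value\<close> is the same for all \<open>\<mu>\<close> and \<open>\<gamma>\<close>, and nonnegative terms in \<open>x - T xh\<close>. So the push-forward
  of \<open>\<pi>h\<close> under \<open>T\<close> is a minimizer. Conversely, a minimizer has couplings with \<open>\<pi>h\<close> along which
  \<open>x - T xh\<close> is arbitrarily small in mean square, and this forces it to be that push-forward;
  the existence of optimal couplings is not needed.
\<close>

section \<open>Symmetric positive definite matrices and their inverses\<close>

lemma sym_pos_def_inner_commute:
  fixes M :: "real ^ 'q ^ 'q"
  assumes "sym_pos_def M"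
  shows "u \<bullet> (M *v v) = v \<bullet> (M *v u)"
  by (metis assms dot_lmul_matrix inner_commute sym_pos_def_def transpose_matrix_vector)

lemma sym_pos_def_nonneg:
  assumes "sym_pos_def M"
  shows "v \<bullet> (M *v v) \<ge> 0"
  using assms unfolding sym_pos_def_def by (cases "v = 0") (auto intro: less_imp_le)

lemma sym_pos_def_invertible:
  fixes M :: "real ^ 'q ^ 'q"
  assumes "sym_pos_def M"
  shows "invertible M"
proof -
  have "x = 0" if "M *v x = 0" for x
    using assms that unfolding sym_pos_def_def by (metis inner_zero_right less_irrefl)
  then show ?thesis
    by (simp add: invertible_left_inverse matrix_left_invertible_ker)
qed

lemma matrix_inv_mult_vector:
  fixes M :: "real ^ 'q ^ 'q"
  assumes "invertible M"
  shows "M *v (matrix_inv M *v v) = v" "matrix_inv M *v (M *v v) = v"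
proof -
  have "M ** matrix_inv M = mat 1 \<and> matrix_inv M ** M = mat 1"
    using assms unfolding invertible_def matrix_inv_def by (rule someI_ex)
  then show "M *v (matrix_inv M *v v) = v" "matrix_inv M *v (M *v v) = v"
    by (simp_all add: matrix_vector_mul_assoc)
qed

text \<open>The substitution \<open>v = M *v w\<close> turns the quadratic form of the inverse into
  that of \<open>M\<close>.\<close>

lemma sym_pos_def_matrix_inv:
  fixes M :: "real ^ 'q ^ 'q"
  assumes M: "sym_pos_def M"
  shows "sym_pos_def (matrix_inv M)"
proof -
  note inv = matrix_inv_mult_vector[OF sym_pos_def_invertible[OF M]]
  have sym: "u \<bullet> (matrix_inv M *v v) = (matrix_inv M *v u) \<bullet> v" for u v
    by (metis inner_commute inv(1) sym_pos_def_inner_commute[OF M])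
  have "transpose (matrix_inv M) *v u = matrix_inv M *v u" for u
    by (rule vector_eq_rdot[THEN iffD1])
      (simp add: dot_lmul_matrix sym)
  then have "transpose (matrix_inv M) = matrix_inv M"
    by (simp only: matrix_eq) blast
  moreover have "v \<bullet> (matrix_inv M *v v) > 0" if "v \<noteq> 0" for v
  proof -
    define w where "w = matrix_inv M *v v"
    have v: "v = M *v w"
      by (simp add: w_def inv)
    with that have "w \<noteq> 0" by auto
    then have "w \<bullet> (M *v w) > 0"
      using M by (simp add: sym_pos_def_def)
    then show ?thesis
      by (metis inner_commute v w_def)
  qed
  ultimately show ?thesis
    by (simp add: sym_pos_def_def)
qed

text \<open>The congruence \<open>H ** C ** transpose H\<close> is in general only positive
  semidefinite; \<open>\<Gamma>\<close> supplies strictness. Hence the matrix inverted in the Kalman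
  gain is invertible for every \<open>H\<close>.\<close>

lemma sym_pos_def_congruence_add:
  fixes H :: "real ^ 'd ^ 'k"
  assumes C: "sym_pos_def C" and G: "sym_pos_def \<Gamma>"
  shows "sym_pos_def (H ** C ** transpose H + \<Gamma>)"
proof -
  have "transpose (H ** C ** transpose H + \<Gamma>)
      = transpose (H ** C ** transpose H) + transpose \<Gamma>"
    by (simp add: transpose_def vec_eq_iff)
  also have "\<dots> = H ** C ** transpose H + \<Gamma>"
    using C G by (simp add: sym_pos_def_def matrix_transpose_mul matrix_mul_assoc)
  finally have 1: "transpose (H ** C ** transpose H + \<Gamma>) = H ** C ** transpose H + \<Gamma>" .
  have 2: "v \<bullet> ((H ** C ** transpose H + \<Gamma>) *v v) > 0" if "v \<noteq> 0" for v
  proof -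
    have "v \<bullet> ((H ** C ** transpose H + \<Gamma>) *v v)
        = (v v* H) \<bullet> (C *v (v v* H)) + v \<bullet> (\<Gamma> *v v)"
      by (simp add: matrix_vector_mult_add_rdistrib inner_add_right dot_lmul_matrix
          flip: matrix_vector_mul_assoc)
    moreover have "(v v* H) \<bullet> (C *v (v v* H)) \<ge> 0"
      by (rule sym_pos_def_nonneg[OF C])
    moreover have "v \<bullet> (\<Gamma> *v v) > 0"
      using G that unfolding sym_pos_def_def by auto
    ultimately show ?thesis by simp
  qed
  from 1 2 show ?thesis
    by (simp add: sym_pos_def_def)
qed

section \<open>The weighted norm: comparison with the Euclidean norm and completion of the
  square\<close>

lemma wnorm_sq:
  assumes "sym_pos_def M"
  shows "(wnorm M v)\<^sup>2 = v \<bullet> (matrix_inv M *v v)"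
  using sym_pos_def_nonneg[OF sym_pos_def_matrix_inv[OF assms]] by (simp add: wnorm_def)

lemma wnorm_uminus: "wnorm M (- v) = wnorm M v"
  using matrix_vector_mult_diff_distrib[of "matrix_inv M" 0 v] by (simp add: wnorm_def)

lemma wnorm_sq_add:
  assumes "sym_pos_def M"
  shows "(wnorm M (u + v))\<^sup>2
    = (wnorm M u)\<^sup>2 + 2 * (u \<bullet> (matrix_inv M *v v)) + (wnorm M v)\<^sup>2"
  using sym_pos_def_inner_commute[OF sym_pos_def_matrix_inv[OF assms], of v u]
  by (simp add: wnorm_sq[OF assms] matrix_vector_right_distrib inner_add_left inner_add_right)

lemma continuous_on_wnorm [continuous_intros]:
  "continuous_on S f \<Longrightarrow> continuous_on S (\<lambda>x. wnorm M (f x))"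
  unfolding wnorm_def by (intro continuous_intros bounded_linear.continuous_on[OF matrix_vector_mul_bounded_linear])

lemma wnorm_measurable [measurable]: "wnorm M \<in> borel_measurable borel"
  by (intro borel_measurable_continuous_onI continuous_on_wnorm continuous_on_id)

lemma matrix_vector_mult_measurable [measurable]:
  fixes A :: "real ^ 'n ^ 'm"
  shows "(*v) A \<in> borel_measurable borel"
  by (intro borel_measurable_continuous_onI continuous_on_id
      bounded_linear.continuous_on[OF matrix_vector_mul_bounded_linear])

lemma wnorm_sq_upper:
  obtains K where "K \<ge> 0" "\<And>v. (wnorm M v)\<^sup>2 \<le> K * (norm v)\<^sup>2"
proof -
  obtain K where K: "K > 0" "\<And>v. norm (matrix_inv M *v v) \<le> norm v * K"
    using bounded_linear.pos_bounded[OF matrix_vector_mul_bounded_linear[of "matrix_inv M"]] by blast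
  have "(wnorm M v)\<^sup>2 \<le> K * (norm v)\<^sup>2" for v
  proof -
    \<comment> \<open>\<open>sqrt\<close> is extended to negative reals as an odd function, so its
      square is the absolute value of its argument.\<close>
    have "(wnorm M v)\<^sup>2 = \<bar>v \<bullet> (matrix_inv M *v v)\<bar>"
      unfolding wnorm_def by (metis real_sqrt_abs real_sqrt_power)
    also have "\<dots> \<le> norm v * norm (matrix_inv M *v v)"
      by (rule Cauchy_Schwarz_ineq2)
    also have "\<dots> \<le> norm v * (norm v * K)"
      by (intro mult_left_mono K) auto
    finally show ?thesis
      by (simp add: power2_eq_square mult_ac)
  qed
  with K(1) that show thesis by (meson less_imp_le)
qed

text \<open>The continuous function \<open>(wnorm M v)\<^sup>2\<close> attains a positive minimum on
  the compact unit sphere, and homogeneity of degree two carries this bound to all vectors. It turns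
  smallness in the weighted norm into smallness in the Euclidean norm.\<close>

lemma wnorm_sq_lower:
  assumes M: "sym_pos_def M"
  obtains c where "c > 0" "\<And>v. c * (norm v)\<^sup>2 \<le> (wnorm M v)\<^sup>2"
proof -
  \<comment> \<open>A unit vector shows that the sphere is nonempty, so that the infimum over it is
    attained.\<close>
  obtain e :: "real ^ 'a" where e: "norm e = 1"
    using vector_choose_size[of 1] by auto
  obtain u :: "real ^ 'a" where u: "u \<in> sphere 0 1" "\<And>v. v \<in> sphere 0 1 \<Longrightarrow> (wnorm M u)\<^sup>2 \<le> (wnorm M v)\<^sup>2"
    using continuous_attains_inf[of "sphere 0 1 :: (real ^ 'a) set" "\<lambda>v. (wnorm M v)\<^sup>2"] e
    by (fastforce intro!: continuous_intros)
  have "u \<noteq> 0" using u by auto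
  then have "(wnorm M u)\<^sup>2 > 0"
    using sym_pos_def_matrix_inv[OF M] by (simp add: wnorm_sq[OF M] sym_pos_def_def)
  moreover have "(wnorm M u)\<^sup>2 * (norm v)\<^sup>2 \<le> (wnorm M v)\<^sup>2" for v
  proof (cases "v = 0")
    case False
    have "(wnorm M v)\<^sup>2 = (wnorm M (norm v *\<^sub>R sgn v))\<^sup>2"
      using False by (simp add: sgn_div_norm)
    also have "\<dots> = (norm v)\<^sup>2 * (wnorm M (sgn v))\<^sup>2"
      by (simp add: wnorm_sq[OF M] matrix_vector_mult_scaleR) (simp add: power2_eq_square)
    finally show ?thesis
      using u(2)[of "sgn v"] False by (simp add: norm_sgn mult.commute mult_left_mono)
  qed simp
  ultimately show thesis using that by blast
qed

text \<open>The cross terms of the two expanded squares cancel because \<open>T\<close> solves the normal equation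
  \<open>C\<^sup>-\<^sup>1 (T xh - xh) + H\<^sup>T \<Gamma>\<^sup>-\<^sup>1 (H (T xh) + \<eta> - y) = 0\<close>.\<close>

lemma enkf_completing_square:
  fixes H :: "real ^ 'd ^ 'k" and y \<eta> :: "real ^ 'k"
  assumes C: "sym_pos_def (Cov \<pi>h)" and G: "sym_pos_def \<Gamma>"
  defines "C \<equiv> Cov \<pi>h" and "T \<equiv> enkf_analysis H \<Gamma> \<pi>h y \<eta>"
  shows "(wnorm C (x - xh))\<^sup>2 + (wnorm \<Gamma> (H *v x + \<eta> - y))\<^sup>2
    = (wnorm C (T xh - xh))\<^sup>2 + (wnorm \<Gamma> (H *v T xh + \<eta> - y))\<^sup>2
      + (wnorm C (x - T xh))\<^sup>2 + (wnorm \<Gamma> (H *v (x - T xh)))\<^sup>2"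
proof -
  define P where "P = H ** C ** transpose H + \<Gamma>"
  define r where "r = H *v xh + \<eta> - y"
  define w where "w = matrix_inv P *v r"
  define t where "t = T xh - xh"
  define s where "s = H *v T xh + \<eta> - y"
  define \<delta> where "\<delta> = x - T xh"
  note C = C[folded C_def]
  \<comment> \<open>\<open>w v* H\<close> is the transpose of \<open>H\<close> applied to
    \<open>w\<close>, so the increment \<open>t\<close> is minus the Kalman gain applied to the
    innovation \<open>r\<close>.\<close>
  have t: "t = - (C *v (w v* H))"
    by (simp add: t_def T_def enkf_analysis_def w_def r_def P_def C_def
        flip: matrix_vector_mul_assoc)
  have r: "r = H *v (C *v (w v* H)) + \<Gamma> *v w"
  proof -
    have "r = P *v w"
      using sym_pos_def_congruence_add[OF C G, of H]
      by (simp add: w_def P_def matrix_inv_mult_vector sym_pos_def_invertible)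
    then show ?thesis
      by (simp add: P_def matrix_vector_mult_add_rdistrib flip: matrix_vector_mul_assoc)
  qed
  \<comment> \<open>The update removes the summand \<open>H *v (C *v (w v* H))\<close> of the
    innovation and leaves the residual \<open>\<Gamma> *v w\<close>.\<close>
  have s: "s = \<Gamma> *v w"
  proof -
    have "s = r + H *v t"
      by (simp add: s_def r_def t_def matrix_vector_mult_diff_distrib)
    then show ?thesis
      using matrix_vector_mult_diff_distrib[of H 0 "C *v (w v* H)"] by (simp add: r t)
  qed
  \<comment> \<open>This and the next identity give the normal equation: the first gradient is
    \<open>- (w v* H)\<close>, the second, pulled back by \<open>H\<close>, is
    \<open>w v* H\<close>.\<close>
  have "matrix_inv C *v t = - (w v* H)"
    using matrix_vector_mult_diff_distrib[of "matrix_inv C" 0 "C *v (w v* H)"]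
    by (simp add: t matrix_inv_mult_vector sym_pos_def_invertible[OF C])
  moreover have "matrix_inv \<Gamma> *v s = w"
    by (simp add: s matrix_inv_mult_vector sym_pos_def_invertible[OF G])
  ultimately have cross: "\<delta> \<bullet> (matrix_inv C *v t) + (H *v \<delta>) \<bullet> (matrix_inv \<Gamma> *v s) = 0"
    by (metis add.left_inverse dot_lmul_matrix inner_commute inner_minus_right)
  have "x - xh = \<delta> + t" "H *v x + \<eta> - y = H *v \<delta> + s"
    by (simp_all add: \<delta>_def t_def s_def matrix_vector_mult_diff_distrib)
  then have "(wnorm C (x - xh))\<^sup>2 + (wnorm \<Gamma> (H *v x + \<eta> - y))\<^sup>2
    = (wnorm C t)\<^sup>2 + (wnorm \<Gamma> s)\<^sup>2 + (wnorm C \<delta>)\<^sup>2 + (wnorm \<Gamma> (H *v \<delta>))\<^sup>2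
      + 2 * (\<delta> \<bullet> (matrix_inv C *v t) + (H *v \<delta>) \<bullet> (matrix_inv \<Gamma> *v s))"
    by (simp add: wnorm_sq_add[OF C] wnorm_sq_add[OF G])
  then show ?thesis
    by (simp only: cross) (simp add: t_def s_def \<delta>_def)
qed

section \<open>Finite second moments and couplings\<close>

lemma P2_D:
  assumes "\<mu> \<in> P2"
  shows "prob_space \<mu>" "sets \<mu> = sets borel" "space \<mu> = UNIV"
    "integrable \<mu> (\<lambda>x. (norm x)\<^sup>2)"
  using assms sets_eq_imp_space_eq[of \<mu> borel] by (auto simp: P2_def)

lemma P2_distr_affine:
  fixes L :: "'a::euclidean_space \<Rightarrow> 'b::euclidean_space"
  assumes mu: "\<mu> \<in> P2" and L: "bounded_linear L"
  shows "distr \<mu> borel (\<lambda>x. L x + c) \<in> P2"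
proof -
  interpret prob_space \<mu> by (rule P2_D[OF mu])
  note [measurable_cong] = P2_D(2)[OF mu]
  have [measurable]: "(\<lambda>x. L x + c) \<in> borel_measurable borel"
    by (intro borel_measurable_continuous_onI continuous_intros
        bounded_linear.continuous_on[OF L])
  obtain K where K: "K > 0" "\<And>x. norm (L x) \<le> norm x * K"
    using bounded_linear.pos_bounded[OF L] by blast
  have int: "integrable \<mu> (\<lambda>x. 2 * K\<^sup>2 * (norm x)\<^sup>2 + 2 * (norm c)\<^sup>2)"
    using P2_D(4)[OF mu] by simp
  have "integrable \<mu> (\<lambda>x. (norm (L x + c))\<^sup>2)"
  proof (rule Bochner_Integration.integrable_bound[OF int _ AE_I2])
    fix x
    have "(norm (L x + c))\<^sup>2 \<le> (norm x * K + norm c)\<^sup>2"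
      using norm_triangle_ineq[of "L x" c] K(2)[of x] by (intro power_mono) auto
    also have "\<dots> \<le> 2 * K\<^sup>2 * (norm x)\<^sup>2 + 2 * (norm c)\<^sup>2"
      using sum_squares_bound[of "norm x * K" "norm c"]
      by (simp add: power2_sum power_mult_distrib mult_ac)
    finally show "norm ((norm (L x + c))\<^sup>2) \<le> norm (2 * K\<^sup>2 * (norm x)\<^sup>2 + 2 * (norm c)\<^sup>2)"
      by simp
  qed measurable
  then show ?thesis
    by (simp add: P2_def prob_space_distr integrable_distr_eq)
qed

text \<open>The domain of \<open>L\<close> is a general Euclidean space so that it may be the
  product on which a coupling lives; all quadratic terms of the coupling cost are of this
  form.\<close>

lemma integrable_wnorm_sq_affine:
  assumes mu: "\<mu> \<in> P2" and L: "bounded_linear L"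
  shows "integrable \<mu> (\<lambda>x. (wnorm M (L x + c))\<^sup>2)"
proof -
  note [measurable_cong] = P2_D(2)[OF mu]
  have [measurable]: "(\<lambda>x. L x + c) \<in> borel_measurable borel"
    by (intro borel_measurable_continuous_onI continuous_intros
        bounded_linear.continuous_on[OF L])
  obtain K where K: "K \<ge> 0" "\<And>v. (wnorm M v)\<^sup>2 \<le> K * (norm v)\<^sup>2"
    using wnorm_sq_upper[of M] by blast
  have "integrable \<mu> (\<lambda>x. K * (norm (L x + c))\<^sup>2)"
    using P2_D(4)[OF P2_distr_affine[OF mu L, of c]] by (simp add: integrable_distr_eq)
  then show ?thesis
    by (rule Bochner_Integration.integrable_bound) (use K in auto)
qed

lemma measurable_prod_borel:
  fixes \<gamma> :: "('a::second_countable_topology \<times> 'b::second_countable_topology) measure"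
  assumes "sets \<gamma> = sets borel"
  shows "fst \<in> borel_measurable \<gamma>" "snd \<in> borel_measurable \<gamma>" "prod.swap \<in> borel_measurable \<gamma>"
  unfolding measurable_cong_sets[OF assms refl]
  by (auto intro!: borel_measurable_continuous_onI continuous_intros continuous_on_swap)

lemma couplings_D:
  assumes "\<gamma> \<in> couplings \<mu> \<nu>"
  shows "prob_space \<gamma>" "sets \<gamma> = sets borel" "distr \<gamma> borel fst = \<mu>" "distr \<gamma> borel snd = \<nu>"
  using assms by (auto simp: couplings_def)

text \<open>The squared norm on the product is the sum of the squared norms of the components, whose
  integrals are the second moments of the marginals.\<close>

lemma couplings_P2:
  assumes mu: "\<mu> \<in> P2" and nu: "\<nu> \<in> P2" and g: "\<gamma> \<in> couplings \<mu> \<nu>"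
  shows "\<gamma> \<in> P2"
proof -
  note [measurable] = measurable_prod_borel[OF couplings_D(2)[OF g]]
  have "integrable (distr \<gamma> borel fst) (\<lambda>x. (norm x)\<^sup>2)"
    "integrable (distr \<gamma> borel snd) (\<lambda>x. (norm x)\<^sup>2)"
    using P2_D(4)[OF mu] P2_D(4)[OF nu] couplings_D[OF g] by simp_all
  then have "integrable \<gamma> (\<lambda>p. (norm (fst p))\<^sup>2 + (norm (snd p))\<^sup>2)"
    by (simp add: integrable_distr_eq)
  then show ?thesis
    using couplings_D[OF g] by (simp add: P2_def norm_prod_def)
qed

text \<open>The product measure is a coupling, so the infimum in \<open>W2\<close> is over a
  nonempty set.\<close>

lemma couplings_nonempty:
  assumes mu: "\<mu> \<in> P2" and nu: "\<nu> \<in> P2"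
  shows "couplings \<mu> \<nu> \<noteq> {}"
proof -
  interpret M: prob_space \<mu> by (rule P2_D[OF mu])
  interpret N: prob_space \<nu> by (rule P2_D[OF nu])
  interpret pair_prob_space \<mu> \<nu> ..
  have fst: "distr (\<mu> \<Otimes>\<^sub>M \<nu>) borel fst = \<mu>"
    using N.distr_pair_fst[of \<mu>] P2_D(2)[OF mu] distr_cong[OF refl, of borel \<mu> "\<mu> \<Otimes>\<^sub>M \<nu>" fst fst]
    by simp
  \<comment> \<open>The second marginal is read off as the first marginal of the product with its
    factors exchanged.\<close>
  have "distr (\<mu> \<Otimes>\<^sub>M \<nu>) borel snd = distr (\<mu> \<Otimes>\<^sub>M \<nu>) \<nu> snd"
    using P2_D(2)[OF nu] by (intro distr_cong) auto
  also have "\<dots> = distr (distr (\<nu> \<Otimes>\<^sub>M \<mu>) (\<mu> \<Otimes>\<^sub>M \<nu>) (\<lambda>(x, y). (y, x))) \<nu> snd"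
    by (subst distr_pair_swap) simp
  also have "\<dots> = distr (\<nu> \<Otimes>\<^sub>M \<mu>) \<nu> fst"
    by (subst distr_distr) (auto simp: comp_def case_prod_beta)
  also have "\<dots> = \<nu>"
    by (rule M.distr_pair_fst)
  finally have snd: "distr (\<mu> \<Otimes>\<^sub>M \<nu>) borel snd = \<nu>" .
  have "sets (\<mu> \<Otimes>\<^sub>M \<nu>) = sets (borel \<Otimes>\<^sub>M borel)"
    by (intro sets_pair_measure_cong P2_D mu nu)
  then have "sets (\<mu> \<Otimes>\<^sub>M \<nu>) = sets borel"
    by (simp only: borel_prod)
  then have "\<mu> \<Otimes>\<^sub>M \<nu> \<in> couplings \<mu> \<nu>"
    using fst snd P.prob_space_axioms by (simp add: couplings_def)
  then show ?thesis by blast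
qed

lemma graph_couplings:
  assumes mu: "\<mu> \<in> P2" and T [measurable]: "T \<in> borel_measurable borel"
  shows "distr \<mu> borel (\<lambda>x. (x, T x)) \<in> couplings \<mu> (distr \<mu> borel T)"
proof -
  interpret prob_space \<mu> by (rule P2_D[OF mu])
  note [measurable_cong] = P2_D(2)[OF mu]
  note [measurable] = measurable_prod_borel[OF refl]
  have "distr \<mu> borel (\<lambda>x. x) = \<mu>"
    using P2_D(2)[OF mu] by (intro distr_id2) auto
  moreover have [measurable]: "(\<lambda>x. (x, T x)) \<in> borel_measurable \<mu>"
    by measurable
  ultimately show ?thesis
    by (simp add: couplings_def prob_space_distr distr_distr comp_def)
qed

text \<open>The objective puts the forecast in the second coordinate, whereas the graph of a
  transport map from the forecast has it in the first; the swap reconciles the two.\<close>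

lemma couplings_swap:
  assumes g: "\<gamma> \<in> couplings \<mu> \<nu>"
  shows "distr \<gamma> borel prod.swap \<in> couplings \<nu> \<mu>"
proof -
  interpret prob_space \<gamma> by (rule couplings_D[OF g])
  note [measurable] = measurable_prod_borel[OF couplings_D(2)[OF g]] measurable_prod_borel[OF refl]
  show ?thesis
    using couplings_D[OF g] by (simp add: couplings_def prob_space_distr distr_distr comp_def)
qed

section \<open>Transport cost and the weighted Wasserstein distance\<close>

lemma transport_cost_sq:
  "(transport_cost M \<gamma>)\<^sup>2 = (LINT p|\<gamma>. (wnorm M (fst p - snd p))\<^sup>2)"
  unfolding transport_cost_def by (simp add: case_prod_beta')

lemma transport_cost_nonneg: "transport_cost M \<gamma> \<ge> 0"
  unfolding transport_cost_def by (simp add: case_prod_beta')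

lemma transport_cost_swap:
  assumes g: "sets \<gamma> = sets borel"
  shows "transport_cost M (distr \<gamma> borel prod.swap) = transport_cost M \<gamma>"
proof -
  note [measurable] = measurable_prod_borel[OF g] measurable_prod_borel[OF refl]
  have "wnorm M (snd p - fst p) = wnorm M (fst p - snd p)" for p
    using wnorm_uminus[of M "fst p - snd p"] by simp
  then show ?thesis
    by (simp add: transport_cost_def case_prod_beta' integral_distr)
qed

lemma W2_nonneg:
  assumes "couplings \<mu> \<nu> \<noteq> {}"
  shows "W2 \<mu> \<nu> M \<ge> 0"
  unfolding W2_def using assms by (intro cINF_greatest transport_cost_nonneg)

lemma W2_le:
  assumes "\<gamma> \<in> couplings \<mu> \<nu>"
  shows "W2 \<mu> \<nu> M \<le> transport_cost M \<gamma>"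
  unfolding W2_def
  by (rule cINF_lower[OF _ assms]) (auto intro!: bdd_belowI[of _ 0] transport_cost_nonneg)

lemma W2_sq_le:
  assumes "\<gamma> \<in> couplings \<mu> \<nu>"
  shows "(W2 \<mu> \<nu> M)\<^sup>2 \<le> (transport_cost M \<gamma>)\<^sup>2"
  using assms by (intro power_mono W2_le W2_nonneg) auto

text \<open>The infimum in \<open>W2\<close> is over unsquared costs, so the bound passes through
  \<open>sqrt\<close>. The number \<open>a\<close> may be negative, as can happen below when it is a
  difference with the observation term.\<close>

lemma W2_sq_ge:
  assumes ne: "couplings \<mu> \<nu> \<noteq> {}"
    and le: "\<And>\<gamma>. \<gamma> \<in> couplings \<mu> \<nu> \<Longrightarrow> a \<le> (transport_cost M \<gamma>)\<^sup>2"
  shows "a \<le> (W2 \<mu> \<nu> M)\<^sup>2"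
proof -
  have "sqrt a \<le> W2 \<mu> \<nu> M"
    unfolding W2_def by (intro cINF_greatest ne real_le_lsqrt transport_cost_nonneg le)
  then show ?thesis
    by (rule sqrt_le_D)
qed

lemma W2_commute: "W2 \<mu> \<nu> M = W2 \<nu> \<mu> M"
proof -
  have "transport_cost M ` couplings \<mu> \<nu> \<subseteq> transport_cost M ` couplings \<nu> \<mu>" for \<mu> \<nu>
  proof
    fix t assume "t \<in> transport_cost M ` couplings \<mu> \<nu>"
    then obtain \<gamma> where g: "\<gamma> \<in> couplings \<mu> \<nu>" "t = transport_cost M \<gamma>"
      by blast
    then show "t \<in> transport_cost M ` couplings \<nu> \<mu>"
      using couplings_swap[OF g(1)] transport_cost_swap[OF couplings_D(2)[OF g(1)]]
      by (metis imageI)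
  qed
  then show ?thesis
    unfolding W2_def by (metis subset_antisym)
qed

section \<open>Equality of laws from closeness in mean square\<close>

text \<open>If \<open>f x\<close> lies in \<open>F\<close>, then \<open>g x\<close> is within
  \<open>d\<close> of \<open>F\<close> unless \<open>f x\<close> and \<open>g x\<close> are at least
  \<open>d\<close> apart, which is improbable by the Markov inequality. Hence \<open>\<mu>\<close>
  gives \<open>F\<close> at most the \<open>\<nu>\<close>-measure of each closed neighbourhood of
  \<open>F\<close>; these decrease to \<open>F\<close> because \<open>F\<close> is closed.\<close>

lemma measure_closed_le_of_close_in_L2:
  fixes \<mu> \<nu> :: "'a::euclidean_space measure"
  assumes nu: "prob_space \<nu>" "sets \<nu> = sets borel" and F: "closed F"
    and close: "\<And>\<epsilon>. \<epsilon> > 0 \<Longrightarrow> \<exists>(P :: 'b measure) f g. prob_space P \<and>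
      f \<in> borel_measurable P \<and> g \<in> borel_measurable P \<and> distr P borel f = \<mu> \<and> distr P borel g = \<nu> \<and>
      integrable P (\<lambda>x. (dist (f x) (g x))\<^sup>2) \<and> (LINT x|P. (dist (f x) (g x))\<^sup>2) < \<epsilon>"
  shows "measure \<mu> F \<le> measure \<nu> F"
\<comment> \<open>For empty \<open>F\<close>, \<open>infdist\<close> takes the default value 0 and
  the neighbourhoods \<open>U n\<close> would be the whole space.\<close>
proof (cases "F = {}")
  case False
  interpret N: prob_space \<nu> by (rule nu)
  define U where "U n = {x. infdist x F \<le> 1 / real (Suc n)}" for n
  have U_closed: "closed (U n)" for n
    unfolding U_def by (intro closed_Collect_le continuous_intros)
  have le: "measure \<mu> F \<le> measure \<nu> (U n)" for n
  proof (rule field_le_epsilon)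
    fix e :: real assume e: "e > 0"
    define d where "d = 1 / real (Suc n)"
    have d: "d > 0" by (simp add: d_def)
    \<comment> \<open>The tolerance \<open>e * d\<^sup>2\<close> makes the Markov bound, which
      divides by \<open>d\<^sup>2\<close>, at most \<open>e\<close>.\<close>
    obtain P :: "'b measure" and f g where P: "prob_space P"
      and [measurable]: "f \<in> borel_measurable P" "g \<in> borel_measurable P"
      and fg: "distr P borel f = \<mu>" "distr P borel g = \<nu>"
      and int: "integrable P (\<lambda>x. (dist (f x) (g x))\<^sup>2)"
      and small: "(LINT x|P. (dist (f x) (g x))\<^sup>2) < e * d\<^sup>2"
      using close[of "e * d\<^sup>2"] e d by auto
    interpret P: prob_space P by (rule P)
    have [measurable]: "F \<in> sets borel" "U n \<in> sets borel"
      using F U_closed by (auto intro: borel_closed)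
    let ?B = "{x \<in> space P. (dist (f x) (g x))\<^sup>2 \<ge> d\<^sup>2}"
    have "measure \<mu> F = measure P (f -` F \<inter> space P)"
      by (simp add: measure_distr flip: fg)
    also have "\<dots> \<le> measure P ((g -` U n \<inter> space P) \<union> ?B)"
    proof (rule P.finite_measure_mono)
      show "f -` F \<inter> space P \<subseteq> (g -` U n \<inter> space P) \<union> ?B"
      proof
        fix x assume x: "x \<in> f -` F \<inter> space P"
        then have "infdist (g x) F \<le> dist (g x) (f x)"
          by (intro infdist_le) auto
        moreover have "d\<^sup>2 \<le> (dist (f x) (g x))\<^sup>2" if "\<not> dist (f x) (g x) < d"
          using that d by (intro power_mono) auto
        ultimately show "x \<in> (g -` U n \<inter> space P) \<union> ?B"
          using x by (cases "dist (f x) (g x) < d") (auto simp: U_def d_def dist_commute)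
      qed
    qed measurable
    also have "\<dots> \<le> measure P (g -` U n \<inter> space P) + measure P ?B"
      by (intro measure_Un_le) measurable
    also have "measure P (g -` U n \<inter> space P) = measure \<nu> (U n)"
      by (simp add: measure_distr flip: fg)
    also have "measure P ?B \<le> (LINT x|P. (dist (f x) (g x))\<^sup>2) / d\<^sup>2"
      using d by (intro integral_Markov_inequality_measure[OF int sets.empty_sets]) auto
    also have "\<dots> \<le> e"
      using small d by (simp add: field_simps)
    finally show "measure \<mu> F \<le> measure \<nu> (U n) + e"
      by simp
  qed
  have "(\<lambda>n. measure \<nu> (U n)) \<longlonglongrightarrow> measure \<nu> (\<Inter>n. U n)"
  proof (rule N.finite_Lim_measure_decseq)
    show "range U \<subseteq> sets \<nu>"
      using U_closed nu(2) by auto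
    show "decseq U"
    proof (intro decseq_SucI subsetI)
      fix n x assume "x \<in> U (Suc n)"
      then have "infdist x F \<le> 1 / real (Suc (Suc n))"
        by (simp add: U_def)
      also have "\<dots> \<le> 1 / real (Suc n)"
        by (rule divide_left_mono) simp_all
      finally show "x \<in> U n"
        by (simp add: U_def)
    qed
  qed
  moreover have "(\<Inter>n. U n) = F"
  proof
    show "(\<Inter>n. U n) \<subseteq> F"
    proof
      fix x assume "x \<in> (\<Inter>n. U n)"
      then have le: "infdist x F \<le> inverse (real (Suc n))" for n
        unfolding U_def inverse_eq_divide by blast
      have "infdist x F \<le> 0"
        by (rule LIMSEQ_le_const[OF LIMSEQ_inverse_real_of_nat]) (use le in blast)
      then show "x \<in> F"
        using in_closed_iff_infdist_zero[OF F False] infdist_nonneg[of x F] by simp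
    qed
  qed (auto simp: U_def)
  ultimately show ?thesis
    using LIMSEQ_le_const[of "\<lambda>n. measure \<nu> (U n)" "measure \<nu> F" "measure \<mu> F"] le by blast
qed simp

text \<open>The closed sets generate the Borel sets, are stable under intersection and include the
  whole space.\<close>

lemma measure_eqI_closed:
  fixes \<mu> \<nu> :: "'a::topological_space measure"
  assumes "finite_measure \<mu>" "finite_measure \<nu>" and s: "sets \<mu> = sets borel" "sets \<nu> = sets borel"
    and eq: "\<And>F. closed F \<Longrightarrow> measure \<mu> F = measure \<nu> F"
  shows "\<mu> = \<nu>"
proof -
  interpret M: finite_measure \<mu> by fact
  interpret N: finite_measure \<nu> by fact
  have "sets borel = sigma_sets UNIV (Collect (closed :: 'a set \<Rightarrow> bool))"
    by (subst borel_eq_closed) simp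
  then show ?thesis
    using s
    by (intro measure_eqI_generator_eq[of "Collect closed" UNIV \<mu> \<nu> "\<lambda>_. UNIV"])
      (auto simp: Int_stable_def M.emeasure_eq_measure N.emeasure_eq_measure eq)
qed

text \<open>The hypothesis is symmetric in the two measures, so the inequality on closed sets holds
  both ways. \<open>P\<close> may change with \<open>\<epsilon>\<close>, which suits couplings that
  only approach the infimum.\<close>

lemma measure_eqI_close_in_L2:
  fixes \<mu> \<nu> :: "'a::euclidean_space measure"
  assumes mu: "prob_space \<mu>" "sets \<mu> = sets borel" and nu: "prob_space \<nu>" "sets \<nu> = sets borel"
    and close: "\<And>\<epsilon>. \<epsilon> > 0 \<Longrightarrow> \<exists>(P :: 'b measure) f g. prob_space P \<and>
      f \<in> borel_measurable P \<and> g \<in> borel_measurable P \<and> distr P borel f = \<mu> \<and> distr P borel g = \<nu> \<and>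
      integrable P (\<lambda>x. (dist (f x) (g x))\<^sup>2) \<and> (LINT x|P. (dist (f x) (g x))\<^sup>2) < \<epsilon>"
  shows "\<mu> = \<nu>"
proof (rule measure_eqI_closed)
  fix F :: "'a set" assume F: "closed F"
  have "measure \<nu> F \<le> measure \<mu> F"
  proof (rule measure_closed_le_of_close_in_L2[OF mu F, where 'b='b])
    fix \<epsilon> :: real assume "\<epsilon> > 0"
    from close[OF this] show "\<exists>(P :: 'b measure) f g. prob_space P \<and>
      f \<in> borel_measurable P \<and> g \<in> borel_measurable P \<and> distr P borel f = \<nu> \<and> distr P borel g = \<mu> \<and>
      integrable P (\<lambda>x. (dist (f x) (g x))\<^sup>2) \<and> (LINT x|P. (dist (f x) (g x))\<^sup>2) < \<epsilon>"
      by (metis (no_types, lifting) dist_commute ext)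
  qed
  moreover have "measure \<mu> F \<le> measure \<nu> F"
    by (rule measure_closed_le_of_close_in_L2[OF nu F close])
  ultimately show "measure \<mu> F = measure \<nu> F"
    by simp
qed (use assms prob_space.finite_measure in auto)

section \<open>The Kalman update and the cost of a coupling\<close>

locale enkf_step =
  fixes H :: "real ^ 'd ^ 'k" and \<Gamma> :: "real ^ 'k ^ 'k"
    and \<pi>h :: "(real ^ 'd) measure" and y \<eta> :: "real ^ 'k"
  assumes noise: "sym_pos_def \<Gamma>"
    and forecast: "\<pi>h \<in> P2"
    and forecast_cov: "sym_pos_def (Cov \<pi>h)"
begin

abbreviation "C \<equiv> Cov \<pi>h"

abbreviation "T \<equiv> enkf_analysis H \<Gamma> \<pi>h y \<eta>"

definition analysis where "analysis = distr \<pi>h borel T"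

text \<open>Twice the minimum of the objective.\<close>

definition min_value where
  "min_value = (LINT x|\<pi>h. (wnorm C (T x - x))\<^sup>2) + (LINT x|\<pi>h. (wnorm \<Gamma> (H *v T x + \<eta> - y))\<^sup>2)"

text \<open>Of the two remainders of the completed square, this one alone controls the Euclidean
  distance, since \<open>C\<close> is positive definite whereas \<open>H\<close> may have a
  kernel.\<close>

definition deviation where
  "deviation \<gamma> = (LINT p|\<gamma>. (wnorm C (fst p - T (snd p)))\<^sup>2)"

text \<open>Reduces measurability, second moments and integrability for \<open>T\<close> to the
  facts on affine maps.\<close>

lemma T_affine:
  obtains L c where "bounded_linear L" "T = (\<lambda>x. L x + c)"
proof -
  define K where "K = C ** transpose H ** matrix_inv (H ** C ** transpose H + \<Gamma>)"
  show thesis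
  proof (rule that)
    show "bounded_linear (\<lambda>x. x - K *v (H *v x))"
      by (intro bounded_linear_sub bounded_linear_ident
          bounded_linear_compose[OF matrix_vector_mul_bounded_linear] matrix_vector_mul_bounded_linear)
    show "T = (\<lambda>x. (x - K *v (H *v x)) + (- (K *v (\<eta> - y))))"
      by (auto simp: fun_eq_iff enkf_analysis_def K_def matrix_vector_right_distrib
          matrix_vector_mult_diff_distrib)
  qed
qed

lemma T_measurable [measurable]: "T \<in> borel_measurable borel"
proof -
  obtain L c where L: "bounded_linear L" and T: "T = (\<lambda>x. L x + c)"
    by (rule T_affine)
  show ?thesis
    unfolding T
    by (intro borel_measurable_continuous_onI continuous_intros bounded_linear.continuous_on[OF L])
qed

lemma analysis_P2: "analysis \<in> P2"
proof -
  obtain L c where L: "bounded_linear L" and T: "T = (\<lambda>x. L x + c)"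
    by (rule T_affine)
  show ?thesis
    unfolding analysis_def T by (rule P2_distr_affine[OF forecast L])
qed

lemma integrable_deviation:
  assumes mu: "\<mu> \<in> P2" and g: "\<gamma> \<in> couplings \<mu> \<pi>h"
  shows "integrable \<gamma> (\<lambda>p. (wnorm C (fst p - T (snd p)))\<^sup>2)"
proof -
  obtain L c where L: "bounded_linear L" and T: "T = (\<lambda>x. L x + c)"
    by (rule T_affine)
  show ?thesis
    using integrable_wnorm_sq_affine[OF couplings_P2[OF mu forecast g],
        of "\<lambda>p. fst p - L (snd p)" C "- c"]
    by (simp add: T bounded_linear_sub bounded_linear_fst
        bounded_linear_compose[OF L bounded_linear_snd] diff_diff_eq)
qed

text \<open>This is \<open>enkf_completing_square\<close> integrated over the coupling, with the
  marginal conditions converting integrals against \<open>\<mu>\<close> and \<open>\<pi>h\<close>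
  into integrals against \<open>\<gamma>\<close>.\<close>

lemma coupling_cost:
  assumes mu: "\<mu> \<in> P2" and g: "\<gamma> \<in> couplings \<mu> \<pi>h"
  shows "(transport_cost C \<gamma>)\<^sup>2 + (LINT x|\<mu>. (wnorm \<Gamma> (H *v x + \<eta> - y))\<^sup>2)
    = min_value + deviation \<gamma> + (LINT p|\<gamma>. (wnorm \<Gamma> (H *v (fst p - T (snd p))))\<^sup>2)"
proof -
  obtain L c where L: "bounded_linear L" and T: "T = (\<lambda>x. L x + c)"
    by (rule T_affine)
  note gP2 = couplings_P2[OF mu forecast g]
  note [measurable] = measurable_prod_borel[OF couplings_D(2)[OF g]]
  note bl = bounded_linear_sub bounded_linear_fst bounded_linear_snd
    bounded_linear_compose[OF matrix_vector_mul_bounded_linear]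
    bounded_linear_compose[OF L]
  have Lsnd: "bounded_linear (\<lambda>p :: (real ^ 'd) \<times> (real ^ 'd). L (snd p))"
    by (intro bl)
  \<comment> \<open>Each of the six squares is the weighted square of an affine function on the
    product; their integrability allows the integrated identity to be split termwise.\<close>
  have i1: "integrable \<gamma> (\<lambda>p. (wnorm C (fst p - snd p))\<^sup>2)"
    using integrable_wnorm_sq_affine[OF gP2, of "\<lambda>p. fst p - snd p" C 0]
    by (simp add: bl)
  have i2: "integrable \<gamma> (\<lambda>p. (wnorm \<Gamma> (H *v fst p + \<eta> - y))\<^sup>2)"
    using integrable_wnorm_sq_affine[OF gP2, of "\<lambda>p. H *v fst p" \<Gamma> "\<eta> - y"]
    by (simp add: bl add_diff_eq)
  have i3: "integrable \<gamma> (\<lambda>p. (wnorm C (T (snd p) - snd p))\<^sup>2)"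
    using integrable_wnorm_sq_affine[OF gP2, of "\<lambda>p. L (snd p) - snd p" C c]
    by (simp add: bl Lsnd T algebra_simps)
  have i4: "integrable \<gamma> (\<lambda>p. (wnorm \<Gamma> (H *v T (snd p) + \<eta> - y))\<^sup>2)"
    using integrable_wnorm_sq_affine[OF gP2, of "\<lambda>p. H *v L (snd p)" \<Gamma> "H *v c + \<eta> - y"]
    by (simp add: bl Lsnd T algebra_simps)
  have i5: "integrable \<gamma> (\<lambda>p. (wnorm \<Gamma> (H *v (fst p - T (snd p))))\<^sup>2)"
    using integrable_wnorm_sq_affine[OF gP2, of "\<lambda>p. H *v (fst p - L (snd p))" \<Gamma> "- (H *v c)"]
    by (simp add: bl Lsnd T algebra_simps)
  note i6 = integrable_deviation[OF mu g]
  have "(LINT x|\<mu>. (wnorm \<Gamma> (H *v x + \<eta> - y))\<^sup>2) = (LINT p|\<gamma>. (wnorm \<Gamma> (H *v fst p + \<eta> - y))\<^sup>2)"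
    by (subst couplings_D(3)[OF g, symmetric]) (simp add: integral_distr)
  moreover have "min_value = (LINT p|\<gamma>. (wnorm C (T (snd p) - snd p))\<^sup>2)
      + (LINT p|\<gamma>. (wnorm \<Gamma> (H *v T (snd p) + \<eta> - y))\<^sup>2)"
  proof -
    have "(LINT x|\<pi>h. f x) = (LINT p|\<gamma>. f (snd p))"
      if [measurable]: "f \<in> borel_measurable borel" for f :: "real ^ 'd \<Rightarrow> real"
      by (subst couplings_D(4)[OF g, symmetric]) (simp add: integral_distr)
    then show ?thesis
      unfolding min_value_def by simp
  qed
  moreover have "(LINT p|\<gamma>. (wnorm C (fst p - snd p))\<^sup>2 + (wnorm \<Gamma> (H *v fst p + \<eta> - y))\<^sup>2)
    = (LINT p|\<gamma>. (wnorm C (T (snd p) - snd p))\<^sup>2 + (wnorm \<Gamma> (H *v T (snd p) + \<eta> - y))\<^sup>2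
      + (wnorm C (fst p - T (snd p)))\<^sup>2 + (wnorm \<Gamma> (H *v (fst p - T (snd p))))\<^sup>2)"
    by (subst enkf_completing_square[OF forecast_cov noise]) (rule refl)
  ultimately show ?thesis
    by (simp add: transport_cost_sq deviation_def i1 i2 i3 i4 i5 i6)
qed

lemma deviation_nonneg: "deviation \<gamma> \<ge> 0"
  by (simp add: deviation_def)

lemma coupling_cost_ge:
  assumes mu: "\<mu> \<in> P2" and g: "\<gamma> \<in> couplings \<mu> \<pi>h"
  shows "min_value + deviation \<gamma>
    \<le> (transport_cost C \<gamma>)\<^sup>2 + (LINT x|\<mu>. (wnorm \<Gamma> (H *v x + \<eta> - y))\<^sup>2)"
  unfolding coupling_cost[OF assms] by simp

section \<open>Existence and uniqueness of the minimizer\<close>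

lemma objective_ge:
  assumes mu: "\<mu> \<in> P2"
  shows "analysis_objective H \<Gamma> \<pi>h y \<eta> \<mu> \<ge> min_value / 2"
proof -
  \<comment> \<open>The observation term is the same for all couplings, so it is moved to the left
    before passing to the infimum.\<close>
  have "min_value - (LINT x|\<mu>. (wnorm \<Gamma> (H *v x + \<eta> - y))\<^sup>2) \<le> (W2 \<mu> \<pi>h C)\<^sup>2"
  proof (rule W2_sq_ge[OF couplings_nonempty[OF mu forecast]])
    fix \<gamma> assume "\<gamma> \<in> couplings \<mu> \<pi>h"
    from coupling_cost_ge[OF mu this] deviation_nonneg[of \<gamma>]
    show "min_value - (LINT x|\<mu>. (wnorm \<Gamma> (H *v x + \<eta> - y))\<^sup>2) \<le> (transport_cost C \<gamma>)\<^sup>2"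
      by simp
  qed
  then show ?thesis
    by (simp add: analysis_objective_def field_simps)
qed

lemma distr_graph_swap:
  fixes S :: "real ^ 'd \<Rightarrow> real ^ 'd"
  assumes [measurable]: "S \<in> borel_measurable borel"
  shows "distr (distr \<pi>h borel (\<lambda>x. (x, S x))) borel prod.swap = distr \<pi>h borel (\<lambda>x. (S x, x))"
proof -
  note [measurable_cong] = P2_D(2)[OF forecast]
  have [measurable]: "(\<lambda>x. (x, S x)) \<in> borel_measurable borel"
    by measurable
  note [measurable] = measurable_prod_borel[OF refl]
  show ?thesis
    by (simp add: distr_distr comp_def)
qed

lemma analysis_coupling: "distr \<pi>h borel (\<lambda>x. (x, T x)) \<in> couplings \<pi>h analysis"
  unfolding analysis_def by (rule graph_couplings[OF forecast T_measurable])

text \<open>After the swap this coupling is carried by the points \<open>(T x, x)\<close>, where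
  both remainders of the completed square vanish.\<close>

lemma analysis_coupling_cost:
  "(transport_cost C (distr \<pi>h borel (\<lambda>x. (x, T x))))\<^sup>2
    + (LINT x|analysis. (wnorm \<Gamma> (H *v x + \<eta> - y))\<^sup>2) = min_value"
proof -
  let ?\<gamma> = "distr \<pi>h borel (\<lambda>x. (x, T x))"
  note [measurable_cong] = P2_D(2)[OF forecast]
  have [measurable]: "(\<lambda>x. (T x, x)) \<in> borel_measurable \<pi>h"
    by measurable
  note [measurable] = measurable_prod_borel[OF refl]
  have zero: "wnorm M 0 = 0" for M :: "real ^ 'n ^ 'n"
    by (simp add: wnorm_def)
  have "deviation (distr ?\<gamma> borel prod.swap) = 0"
    "(LINT p|distr ?\<gamma> borel prod.swap. (wnorm \<Gamma> (H *v (fst p - T (snd p))))\<^sup>2) = 0"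
    by (simp_all add: distr_graph_swap deviation_def integral_distr zero)
  then show ?thesis
    using coupling_cost[OF analysis_P2 couplings_swap[OF analysis_coupling]]
    by (simp add: transport_cost_swap)
qed

text \<open>The graph coupling bounds \<open>W2\<close> from above, and \<open>objective_ge\<close>
  is the matching lower bound.\<close>

lemma objective_analysis: "analysis_objective H \<Gamma> \<pi>h y \<eta> analysis = min_value / 2"
  using objective_ge[OF analysis_P2] analysis_coupling_cost
    W2_sq_le[OF couplings_swap[OF analysis_coupling], of C]
  by (simp add: transport_cost_swap analysis_objective_def field_simps)

lemma objective_eq_imp:
  assumes mu: "\<mu> \<in> P2" and le: "analysis_objective H \<Gamma> \<pi>h y \<eta> \<mu> \<le> min_value / 2"
  shows "\<mu> = analysis"
proof (rule measure_eqI_close_in_L2[where 'b="(real ^ 'd) \<times> (real ^ 'd)"])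
  fix \<epsilon> :: real assume eps: "\<epsilon> > 0"
  obtain c where c: "c > 0" "\<And>v. c * (norm v)\<^sup>2 \<le> (wnorm C v)\<^sup>2"
    by (rule wnorm_sq_lower[OF forecast_cov]) blast
  \<comment> \<open>Otherwise the excess \<open>c * \<epsilon>\<close> over
    \<open>min_value\<close>, common to all couplings, would survive in the infimum and contradict
    \<open>le\<close>. The factor \<open>c\<close> is later divided out in passing to the Euclidean
    distance.\<close>
  have "\<exists>\<gamma>\<in>couplings \<mu> \<pi>h. deviation \<gamma> < c * \<epsilon>"
  proof (rule ccontr)
    assume "\<not> (\<exists>\<gamma>\<in>couplings \<mu> \<pi>h. deviation \<gamma> < c * \<epsilon>)"
    then have "min_value + c * \<epsilon> - (LINT x|\<mu>. (wnorm \<Gamma> (H *v x + \<eta> - y))\<^sup>2) \<le> (W2 \<mu> \<pi>h C)\<^sup>2"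
      by (intro W2_sq_ge couplings_nonempty mu forecast) (use coupling_cost_ge[OF mu] in force)
    with le have "c * \<epsilon> \<le> 0"
      by (simp add: analysis_objective_def field_simps)
    then show False
      using c(1) eps by (simp add: mult_le_0_iff)
  qed
  then obtain \<gamma> where g: "\<gamma> \<in> couplings \<mu> \<pi>h" and small: "deviation \<gamma> < c * \<epsilon>"
    by blast
  note [measurable] = measurable_prod_borel[OF couplings_D(2)[OF g]]
  have int: "integrable \<gamma> (\<lambda>p. (wnorm C (fst p - T (snd p)))\<^sup>2 / c)"
    using integrable_deviation[OF mu g] by simp
  have bound: "(dist (fst p) (T (snd p)))\<^sup>2 \<le> (wnorm C (fst p - T (snd p)))\<^sup>2 / c" for p
    using c(2)[of "fst p - T (snd p)"] c(1) by (simp add: dist_norm field_simps)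
  have int': "integrable \<gamma> (\<lambda>p. (dist (fst p) (T (snd p)))\<^sup>2)"
    by (rule Bochner_Integration.integrable_bound[OF int]) (use bound c in auto)
  have "(LINT p|\<gamma>. (dist (fst p) (T (snd p)))\<^sup>2) \<le> deviation \<gamma> / c"
    using integral_mono[OF int' int] bound by (simp add: deviation_def)
  also have "\<dots> < \<epsilon>"
    using small c(1) by (simp add: field_simps)
  finally have "(LINT p|\<gamma>. (dist (fst p) (T (snd p)))\<^sup>2) < \<epsilon>" .
  moreover have "distr \<gamma> borel (\<lambda>p. T (snd p)) = analysis"
    unfolding analysis_def
    by (subst couplings_D(4)[OF g, symmetric]) (simp add: distr_distr comp_def)
  ultimately show "\<exists>(P :: ((real ^ 'd) \<times> (real ^ 'd)) measure) f g. prob_space P \<and>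
      f \<in> borel_measurable P \<and> g \<in> borel_measurable P \<and> distr P borel f = \<mu> \<and> distr P borel g = analysis \<and>
      integrable P (\<lambda>x. (dist (f x) (g x))\<^sup>2) \<and> (LINT x|P. (dist (f x) (g x))\<^sup>2) < \<epsilon>"
    using couplings_D[OF g] int'
    by (intro exI[of _ \<gamma>] exI[of _ fst] exI[of _ "\<lambda>p. T (snd p)"]) auto
qed (use P2_D[OF mu] P2_D[OF analysis_P2] in auto)

lemma is_arg_min_iff:
  "is_arg_min (analysis_objective H \<Gamma> \<pi>h y \<eta>) (\<lambda>\<mu>. \<mu> \<in> P2) \<pi> \<longleftrightarrow> \<pi> = analysis"
proof
  assume "is_arg_min (analysis_objective H \<Gamma> \<pi>h y \<eta>) (\<lambda>\<mu>. \<mu> \<in> P2) \<pi>"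
  then have "\<pi> \<in> P2" "\<not> analysis_objective H \<Gamma> \<pi>h y \<eta> analysis < analysis_objective H \<Gamma> \<pi>h y \<eta> \<pi>"
    using analysis_P2 by (auto simp: is_arg_min_def)
  then show "\<pi> = analysis"
    by (intro objective_eq_imp) (auto simp: objective_analysis)
next
  assume "\<pi> = analysis"
  then show "is_arg_min (analysis_objective H \<Gamma> \<pi>h y \<eta>) (\<lambda>\<mu>. \<mu> \<in> P2) \<pi>"
    using analysis_P2 objective_ge by (force simp: is_arg_min_def objective_analysis)
qed

section \<open>Optimality and uniqueness of the transport map\<close>

text \<open>Added to the same observation term, the squared graph cost and the squared distance both
  give \<open>min_value\<close>, so optimality of the map comes from minimality of the
  objective.\<close>

lemma transport_cost_analysis:
  "transport_cost C (distr \<pi>h borel (\<lambda>x. (x, T x))) = W2 \<pi>h analysis C"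
proof (rule power2_eq_imp_eq)
  show "(transport_cost C (distr \<pi>h borel (\<lambda>x. (x, T x))))\<^sup>2 = (W2 \<pi>h analysis C)\<^sup>2"
    using objective_analysis analysis_coupling_cost
    by (simp add: analysis_objective_def W2_commute[of analysis] field_simps)
qed (use analysis_coupling in \<open>auto intro: transport_cost_nonneg W2_nonneg\<close>)

lemma optimal_transport_map_analysis: "optimal_transport_map C \<pi>h analysis T"
  by (simp add: optimal_transport_map_def analysis_coupling transport_cost_analysis)

text \<open>An optimal coupling of \<open>\<pi>h\<close> and \<open>analysis\<close> has no excess
  over \<open>min_value\<close>, hence zero deviation; on the graph of \<open>S\<close> this says
  that \<open>S x - T x\<close> vanishes in mean square.\<close>

lemma optimal_transport_map_unique:
  assumes S: "optimal_transport_map C \<pi>h analysis S"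
  shows "AE x in \<pi>h. S x = T x"
proof -
  let ?\<gamma> = "distr \<pi>h borel (\<lambda>x. (x, S x))"
  note [measurable_cong] = P2_D(2)[OF forecast]
  have [measurable]: "S \<in> borel_measurable borel"
    and g: "?\<gamma> \<in> couplings \<pi>h analysis" and cost: "transport_cost C ?\<gamma> = W2 \<pi>h analysis C"
    using S by (auto simp: optimal_transport_map_def)
  have [measurable]: "(\<lambda>x. (S x, x)) \<in> borel_measurable \<pi>h"
    by measurable
  note g' = couplings_swap[OF g]
  note [measurable] = measurable_prod_borel[OF refl]
  \<comment> \<open>The graphs of \<open>S\<close> and \<open>T\<close> have equal cost and the same
    observation term, which sum to \<open>min_value\<close> for \<open>T\<close>.\<close>
  have "deviation (distr ?\<gamma> borel prod.swap) \<le> 0"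
    using coupling_cost_ge[OF analysis_P2 g'] analysis_coupling_cost
    by (simp add: transport_cost_swap cost transport_cost_analysis)
  then have "(LINT x|\<pi>h. (wnorm C (S x - T x))\<^sup>2) \<le> 0"
    by (simp add: deviation_def distr_graph_swap integral_distr)
  then have zero: "(LINT x|\<pi>h. (wnorm C (S x - T x))\<^sup>2) = 0"
    by (intro antisym) auto
  moreover have "integrable \<pi>h (\<lambda>x. (wnorm C (S x - T x))\<^sup>2)"
    using integrable_deviation[OF analysis_P2 g'] by (simp add: distr_graph_swap integrable_distr_eq)
  ultimately have "AE x in \<pi>h. (wnorm C (S x - T x))\<^sup>2 = 0"
    by (subst (asm) integral_nonneg_eq_0_iff_AE) auto
  moreover obtain c where c: "c > 0" "\<And>v. c * (norm v)\<^sup>2 \<le> (wnorm C v)\<^sup>2"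
    by (rule wnorm_sq_lower[OF forecast_cov]) blast
  ultimately show ?thesis
  proof (elim AE_mp, intro AE_I2 impI)
    fix x assume "(wnorm C (S x - T x))\<^sup>2 = 0"
    then have "c * (norm (S x - T x))\<^sup>2 \<le> 0"
      using c(2) by metis
    then show "S x = T x"
      using c(1) by (simp add: mult_le_0_iff)
  qed
qed

end

text \<open>Altering a map on a null set of \<open>\<pi>h\<close> does not affect the coupling it
  induces, so uniqueness of the optimal map is expressed almost everywhere.\<close>

theorem theorem2p5:
  fixes H :: "real ^ 'd ^ 'k" and \<Gamma> :: "real ^ 'k ^ 'k"
    and \<pi>h :: "(real ^ 'd) measure" and y \<eta> :: "real ^ 'k"
  assumes "sym_pos_def \<Gamma>"
    and "\<pi>h \<in> P2"
    and "sym_pos_def (Cov \<pi>h)"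
  shows "(\<exists>!\<pi>. is_arg_min (analysis_objective H \<Gamma> \<pi>h y \<eta>) (\<lambda>\<mu>. \<mu> \<in> P2) \<pi>)
    \<and> (\<forall>\<pi>. is_arg_min (analysis_objective H \<Gamma> \<pi>h y \<eta>) (\<lambda>\<mu>. \<mu> \<in> P2) \<pi> \<longrightarrow>
           (let T = (\<lambda>xh. xh - (Cov \<pi>h ** transpose H
                        ** matrix_inv (H ** Cov \<pi>h ** transpose H + \<Gamma>)) *v (H *v xh + \<eta> - y))
            in optimal_transport_map (Cov \<pi>h) \<pi>h \<pi> T
               \<and> (\<forall>T'. optimal_transport_map (Cov \<pi>h) \<pi>h \<pi> T' \<longrightarrow> (AE xh in \<pi>h. T' xh = T xh))
               \<and> T = enkf_analysis H \<Gamma> \<pi>h y \<eta>))"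
proof -
  interpret enkf_step H \<Gamma> \<pi>h y \<eta>
    using assms by unfold_locales
  have T_eq: "(\<lambda>xh. xh - (Cov \<pi>h ** transpose H
      ** matrix_inv (H ** Cov \<pi>h ** transpose H + \<Gamma>)) *v (H *v xh + \<eta> - y)) = T"
    by (simp add: fun_eq_iff enkf_analysis_def)
  show ?thesis
    unfolding Let_def T_eq is_arg_min_iff
    using optimal_transport_map_analysis optimal_transport_map_unique by blast
qed

end
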